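(* Let $s,k,t \in \mathbb{N}$ with $k \geq t \geq 2$ and let $r = s(k-t+1)$. For every $r$-edge-colouring of the complete $k$-uniform hypergraph $\mathcal{K}_{\mathbb{N}}^{(k)}$ (vertex set $\mathbb{N}$, edge set $\binom{\mathbb{N}}{k}$), the vertex set $\mathbb{N}$ can be core-partitioned into $s$ monochromatic $t$-tight Berge-paths (finite or infinite) of pairwise different colours.
   Context: A $k$-graph is a pair $(V,\mathcal{E})$ with $\mathcal{E} \subseteq \binom{V}{k}$. For integers $2 \le t \le k$ and $\ell \ge 1$, a finite $t$-tight Berge-path of length $\ell$ in a $k$-graph is a pair $(X,F)$ where $X=\{v_1,\dots,v_{\ell+t-1}\}$ is a set of $\ell+t-1$ distinct vertices, $F=\{e_1,\dots,e_\ell\}$ is a set of $\ell$ distinct edges, and $v_i,v_{i+1},\dots,v_{i+t-1} \in e_i$ for all $i\in[\ell]$. A $t$-tight Berge-path of length $0$ is a pair $(\{v\},\emptyset)$. An infinite $t$-tight Berge-path is a pair $(X,F)$ with $X=\{v_i : i\in\mathbb{N}\}$ (distinct vertices), $F=\{e_i: i\in\mathbb{N}\}$ (distinct edges) and $v_i,\dots,v_{i+t-1}\in e_i$ for all $i$. $X$ is called the core of the path. Paths $(X_1,F_1),\dots,(X_s,F_s)$ core-partition $V$ if $X_1\cup\dots\cup X_s$ is a partition of $V$. Given an edge-colouring $\varphi$, a path $(X,F)$ is monochromatic in colour $c$ if $\varphi(f)=c$ for all $f\in F$. *)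

theory Defs
  imports Main "HOL-Library.Ramsey" "HOL-Library.FuncSet" "HOL-Library.Disjoint_Sets"
begin

type_synonym 'a hypergraph = "'a set \<times> 'a set set"

definition kgraph :: "nat \<Rightarrow> 'a hypergraph \<Rightarrow> bool" where
  "kgraph k H \<longleftrightarrow> snd H \<subseteq> nsets (fst H) k"

definition complete_kgraph :: "'a set \<Rightarrow> nat \<Rightarrow> 'a hypergraph" where
  "complete_kgraph V k = (V, nsets V k)"

lemma kgraph_complete_kgraph: "kgraph k (complete_kgraph V k)"
  by (simp add: kgraph_def complete_kgraph_def)

text \<open>A path is a pair of its core and its set of edges; vertices and edges are enumerated
  from 0. For length 0 the core is a single vertex (not \<open>t - 1\<close> vertices), and it is never empty.\<close>

definition finite_berge_path ::
    "nat \<Rightarrow> 'a hypergraph \<Rightarrow> nat \<Rightarrow> 'a set \<times> 'a set set \<Rightarrow> bool" where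
  "finite_berge_path t H l P \<longleftrightarrow>
    (if l = 0 then \<exists>v \<in> fst H. P = ({v}, {})
     else \<exists>v e. inj_on v {..<l + t - 1} \<and> v ` {..<l + t - 1} \<subseteq> fst H \<and>
                inj_on e {..<l} \<and> e ` {..<l} \<subseteq> snd H \<and>
                (\<forall>i<l. v ` {i..<i + t} \<subseteq> e i) \<and>
                P = (v ` {..<l + t - 1}, e ` {..<l}))"

definition infinite_berge_path ::
    "nat \<Rightarrow> 'a hypergraph \<Rightarrow> 'a set \<times> 'a set set \<Rightarrow> bool" where
  "infinite_berge_path t H P \<longleftrightarrow>
    (\<exists>(v :: nat \<Rightarrow> 'a) (e :: nat \<Rightarrow> 'a set).
       inj v \<and> range v \<subseteq> fst H \<and> inj e \<and> range e \<subseteq> snd H \<and>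
       (\<forall>i. v ` {i..<i + t} \<subseteq> e i) \<and>
       P = (range v, range e))"

definition berge_path :: "nat \<Rightarrow> 'a hypergraph \<Rightarrow> 'a set \<times> 'a set set \<Rightarrow> bool" where
  "berge_path t H P \<longleftrightarrow> (\<exists>l. finite_berge_path t H l P) \<or> infinite_berge_path t H P"

abbreviation core :: "'a set \<times> 'a set set \<Rightarrow> 'a set" where
  "core P \<equiv> fst P"

definition monochromatic_in ::
    "('a set \<Rightarrow> 'c) \<Rightarrow> 'c \<Rightarrow> 'a set \<times> 'a set set \<Rightarrow> bool" where
  "monochromatic_in \<phi> c P \<longleftrightarrow> (\<forall>f \<in> snd P. \<phi> f = c)"

text \<open>Colourings need not use every colour; values outside the edge set are irrelevant.\<close>

definition edge_colouring :: "nat \<Rightarrow> 'a hypergraph \<Rightarrow> ('a set \<Rightarrow> nat) \<Rightarrow> bool" where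
  "edge_colouring r H \<phi> \<longleftrightarrow> \<phi> \<in> snd H \<rightarrow> {1..r}"

definition core_partition ::
    "'a set \<Rightarrow> nat \<Rightarrow> (nat \<Rightarrow> 'a set \<times> 'a set set) \<Rightarrow> bool" where
  "core_partition V s P \<longleftrightarrow>
    disjoint_family_on (\<lambda>i. core (P i)) {1..s} \<and>
    partition_on V ((\<lambda>i. core (P i)) ` {1..s})"

end

theory Submission
  imports Defs "HOL-Library.Sublist"
begin

text \<open>
  Fix a non-principal ultrafilter and extend the colouring downwards to all sets \<open>A\<close> with at most
  \<open>k\<close> vertices, giving \<open>A\<close> the colour that \<open>insert w A\<close> has for almost all \<open>w\<close>. For \<open>m = k - t + 1\<close>
  there are at most \<open>s\<close> colours such that every vertex lies in an \<open>m\<close>-set of one of them: otherwise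
  split the \<open>s * m\<close> colours into \<open>m\<close> blocks of size \<open>s\<close>, and for each block take a vertex that lies
  in no \<open>m\<close>-set with a colour of the block; an \<open>m\<close>-set containing all these vertices has no colour
  left. Take such a set of colours that is minimal, so that each of its colours \<open>c\<close> has a private
  vertex at which the path of colour \<open>c\<close> can start.

  The paths are built greedily and simultaneously. An uncovered vertex \<open>v\<close> in an \<open>m\<close>-set \<open>Z'\<close> of
  colour \<open>c\<close> is added to the path of colour \<open>c\<close>, which currently ends in an \<open>m\<close>-set \<open>Z\<close>, after
  \<open>t - 1\<close> generic vertices. A window of \<open>t\<close> consecutive vertices then consists of a vertex of \<open>Z\<close>
  or \<open>Z'\<close> and of \<open>t - 1\<close> others, and is contained in a \<open>k\<close>-set of colour \<open>c\<close>. If already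
  \<open>v \<in> Z\<close>, then \<open>v\<close> is appended directly. Single vertices set aside at the start serve as paths
  of length 0 in the remaining colours.
\<close>

section \<open>Ultrafilters and the downward extension of the colouring\<close>

text \<open>Smaller filters have more large sets, so ultrafilters are the minimal proper filters,
  and Zorn's lemma is applied to the reversed order.\<close>

lemma ex_ultrafilter_le:
  fixes F :: "'a filter"
  assumes "F \<noteq> bot"
  shows "\<exists>U\<le>F. U \<noteq> bot \<and> (\<forall>P. eventually P U \<or> eventually (\<lambda>x. \<not> P x) U)"
proof -
  let ?A = "{G. G \<noteq> bot \<and> G \<le> F}" and ?P = "\<lambda>G H :: 'a filter. H \<le> G"
  have "\<exists>m\<in>?A. \<forall>a\<in>?A. ?P m a \<longrightarrow> a = m"
  proof (rule predicate_Zorn)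
    show "partial_order_on ?A (relation_of ?P ?A)"
      by (auto simp: partial_order_on_def preorder_on_def refl_on_def trans_def antisym_def
          relation_of_def)
  next
    fix C assume C: "C \<in> Chains (relation_of ?P ?A)"
    have CA: "C \<subseteq> ?A" and lin: "\<And>a b. a \<in> C \<Longrightarrow> b \<in> C \<Longrightarrow> a \<le> b \<or> b \<le> a"
      using C by (auto simp: Chains_def relation_of_def)
    show "\<exists>u\<in>?A. \<forall>a\<in>C. ?P a u"
    proof (cases "C = {}")
      case True
      then show ?thesis using assms by auto
    next
      case False
      \<comment> \<open>Only what is large for some member of a chain is large for its infimum,
        which is therefore proper.\<close>
      have "eventually (\<lambda>_. False) (Inf C) \<longleftrightarrow> (\<exists>b\<in>C. eventually (\<lambda>_. False) b)"
        by (rule eventually_Inf_base[OF False]) (metis inf.orderI inf.commute lin order_refl inf.absorb_iff1)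
      then have "Inf C \<noteq> bot"
        using CA by (auto simp: eventually_False)
      moreover obtain G where "G \<in> C" using False by blast
      then have "Inf C \<le> F"
        using CA by (auto intro: Inf_lower2)
      ultimately show ?thesis by (auto intro: Inf_lower)
    qed
  qed
  then obtain U where U: "U \<noteq> bot" "U \<le> F"
    and max: "\<And>G. G \<noteq> bot \<Longrightarrow> G \<le> F \<Longrightarrow> G \<le> U \<Longrightarrow> G = U" by auto
  \<comment> \<open>Restricting \<open>U\<close> to the points with \<open>P\<close> gives the
    improper filter or, by minimality, \<open>U\<close> itself.\<close>
  have "eventually P U \<or> eventually (\<lambda>x. \<not> P x) U" for P
  proof (cases "inf U (principal {x. P x}) = bot")
    case True
    then have "eventually (\<lambda>_. False) (inf U (principal {x. P x}))" by simp
    then show ?thesis by (simp add: eventually_inf_principal)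
  next
    case False
    then have "inf U (principal {x. P x}) = U"
      using U by (intro max) (auto intro: le_infI1)
    moreover have "eventually P (inf U (principal {x. P x}))"
      by (simp add: eventually_inf_principal)
    ultimately show ?thesis by simp
  qed
  with U show ?thesis by blast
qed

text \<open>The last conjunct holds because finitely many large sets have a common element; it is
  all that is used later about the ultrafilter.\<close>

lemma generic_extension_of_colouring:
  fixes \<phi> :: "'a set \<Rightarrow> 'c"
  assumes inf: "infinite (UNIV :: 'a set)" and R: "finite R" and \<phi>: "\<phi> \<in> nsets UNIV k \<rightarrow> R"
  shows "\<exists>\<chi>. (\<forall>A. finite A \<longrightarrow> card A = k \<longrightarrow> \<chi> A = \<phi> A) \<and>
    (\<forall>A. finite A \<longrightarrow> card A \<le> k \<longrightarrow> \<chi> A \<in> R) \<and>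
    (\<forall>\<A> F. finite \<A> \<longrightarrow> finite F \<longrightarrow> (\<forall>A\<in>\<A>. finite A \<and> card A < k) \<longrightarrow>
      (\<exists>w. w \<notin> F \<and> (\<forall>A\<in>\<A>. \<chi> (insert w A) = \<chi> A)))"
proof -
  have "(cofinite :: 'a filter) \<noteq> bot" using inf by simp
  then obtain U :: "'a filter" where U: "U \<le> cofinite" "U \<noteq> bot"
    and ultra: "\<And>P. eventually P U \<or> eventually (\<lambda>x. \<not> P x) U"
    using ex_ultrafilter_le by blast
  have fresh: "\<forall>\<^sub>F w in U. w \<notin> F" if "finite F" for F
    using that U(1) by (intro filter_leD[OF U(1)]) (simp add: eventually_cofinite)
  \<comment> \<open>\<open>n\<close> counts the missing vertices: \<open>g n A\<close> is meaningful
    only for \<open>card A + n = k\<close>.\<close>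
  define g where "g = rec_nat \<phi> (\<lambda>_ h A. SOME c. \<forall>\<^sub>F w in U. h (insert w A) = c)"
  have g0: "g 0 = \<phi>" and gS: "\<And>n A. g (Suc n) A = (SOME c. \<forall>\<^sub>F w in U. g n (insert w A) = c)"
    by (simp_all add: g_def)
  have g: "card A + n = k \<Longrightarrow> finite A \<Longrightarrow>
      g n A \<in> R \<and> (n > 0 \<longrightarrow> (\<forall>\<^sub>F w in U. g (n - 1) (insert w A) = g n A))" for n A
  proof (induction n arbitrary: A)
    case 0
    then show ?case using \<phi> by (auto simp: g0 nsets_def)
  next
    case (Suc n)
    have ev: "\<forall>\<^sub>F w in U. g n (insert w A) \<in> R"
      by (rule eventually_mono[OF fresh[OF Suc.prems(2)]]) (use Suc in auto)
    \<comment> \<open>If each single colour were avoided by almost all \<open>w\<close>, then,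
      \<open>R\<close> being finite, almost all \<open>w\<close> would avoid all of
      \<open>R\<close>.\<close>
    have "\<exists>c\<in>R. \<forall>\<^sub>F w in U. g n (insert w A) = c"
    proof (rule ccontr)
      assume "\<not> ?thesis"
      then have "\<forall>c\<in>R. \<forall>\<^sub>F w in U. g n (insert w A) \<noteq> c" using ultra by metis
      then have "\<forall>\<^sub>F w in U. \<forall>c\<in>R. g n (insert w A) \<noteq> c"
        by (rule eventually_ball_finite[OF R])
      with ev have "\<forall>\<^sub>F w in U. False" by eventually_elim auto
      with U show False by simp
    qed
    then obtain c where c: "c \<in> R" "\<forall>\<^sub>F w in U. g n (insert w A) = c" by blast
    then have *: "\<forall>\<^sub>F w in U. g n (insert w A) = g (Suc n) A"
      unfolding gS by (rule_tac someI)
    have "\<forall>\<^sub>F w in U. c = g (Suc n) A"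
      using c(2) * by eventually_elim simp
    then have "g (Suc n) A = c" using U by (simp add: eventually_const_iff)
    then show ?case using c by auto
  qed
  define \<chi> where "\<chi> A = g (k - card A) A" for A
  have "\<exists>w. w \<notin> F \<and> (\<forall>A\<in>\<A>. \<chi> (insert w A) = \<chi> A)"
    if "finite \<A>" "finite F" "\<forall>A\<in>\<A>. finite A \<and> card A < k" for \<A> F
  proof -
    have "\<forall>\<^sub>F w in U. \<chi> (insert w A) = \<chi> A" if A: "finite A" "card A < k" for A
    proof -
      have "\<forall>\<^sub>F w in U. g (k - card A - 1) (insert w A) = g (k - card A) A"
        using g[of A "k - card A"] A by auto
      with fresh[OF A(1)] show ?thesis
        by eventually_elim (use A in \<open>auto simp: \<chi>_def\<close>)
    qed
    with that have "\<forall>\<^sub>F w in U. \<forall>A\<in>\<A>. \<chi> (insert w A) = \<chi> A"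
      by (intro eventually_ball_finite) auto
    with fresh[OF that(2)] have "\<forall>\<^sub>F w in U. w \<notin> F \<and> (\<forall>A\<in>\<A>. \<chi> (insert w A) = \<chi> A)"
      by eventually_elim auto
    then show ?thesis using U(2) by (rule eventually_happens'[rotated])
  qed
  moreover have "\<chi> A \<in> R" if "finite A" "card A \<le> k" for A
    using g[of A "k - card A"] that by (simp add: \<chi>_def)
  ultimately show ?thesis
    by (intro exI[of _ \<chi>]) (auto simp: \<chi>_def g0)
qed

section \<open>End segments of vertex lists\<close>

text \<open>For \<open>t \<ge> 1\<close> these are the last \<open>t - 1\<close> entries, or all
  entries of a shorter list: the window of the next edge without the vertex still to be
  appended.\<close>

definition end_segment :: "nat \<Rightarrow> 'a list \<Rightarrow> 'a set" where
  "end_segment t xs = set (drop (Suc (length xs) - t) xs)"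

lemma end_segment_subset: "end_segment t xs \<subseteq> set xs"
  by (auto simp: end_segment_def dest: in_set_dropD)

lemma finite_end_segment [simp]: "finite (end_segment t xs)"
  by (simp add: end_segment_def)

lemma card_end_segment_le: "card (end_segment t xs) \<le> t - 1"
  unfolding end_segment_def by (rule order_trans[OF card_length]) auto

lemma end_segment_append:
  "end_segment t (xs @ ys) \<subseteq> end_segment t xs \<union> set ys"
  using set_drop_subset_set_drop[OF diff_le_mono, of "Suc (length xs)" "Suc (length xs + length ys)" t xs]
  by (auto simp: end_segment_def dest: in_set_dropD)

lemma last_in_end_segment_append:
  assumes "xs \<noteq> []" "length ys + 2 \<le> t"
  shows "last xs \<in> end_segment t (xs @ ys)"
proof -
  obtain xs0 x where "xs = xs0 @ [x]" using assms(1) by (cases xs rule: rev_cases) auto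
  then show ?thesis using assms(2) by (simp add: end_segment_def)
qed

lemma end_segment_append_full:
  assumes "Suc (length ys) = t"
  shows "end_segment t (xs @ ys) = set ys"
  using assms by (simp add: end_segment_def)

section \<open>Extension of a single path by generic vertices\<close>

locale generic_colouring =
  fixes k t :: nat and \<chi> :: "'a set \<Rightarrow> 'c"
  assumes two_le_t: "2 \<le> t" and t_le_k: "t \<le> k"
    and generic_vertex: "\<And>\<A> F. finite \<A> \<Longrightarrow> finite F \<Longrightarrow>
      (\<And>A. A \<in> \<A> \<Longrightarrow> finite A \<and> card A < k) \<Longrightarrow>
      \<exists>w. w \<notin> F \<and> (\<forall>A\<in>\<A>. \<chi> (insert w A) = \<chi> A)"
begin

text \<open>The vertices are chosen one by one, each generic for the unions of a member of
  \<open>\<A>\<close> with earlier choices. The vertices of \<open>W\<close> can then be removed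
  again, the latest first, without changing the colour.\<close>

lemma generic_list:
  assumes "finite \<A>" "finite F" "\<forall>A\<in>\<A>. finite A"
  shows "\<exists>ws. length ws = n \<and> distinct ws \<and> set ws \<inter> F = {} \<and>
    (\<forall>A\<in>\<A>. A \<inter> set ws = {} \<and> (\<forall>W\<subseteq>set ws. card (A \<union> W) \<le> k \<longrightarrow> \<chi> (A \<union> W) = \<chi> A))"
proof (induction n)
  case 0
  then show ?case by (intro exI[of _ "[]"]) auto
next
  case (Suc n)
  then obtain ws where ws: "length ws = n" "distinct ws" "set ws \<inter> F = {}"
    and gen: "\<forall>A\<in>\<A>. A \<inter> set ws = {} \<and>
      (\<forall>W\<subseteq>set ws. card (A \<union> W) \<le> k \<longrightarrow> \<chi> (A \<union> W) = \<chi> A)"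
    by (elim exE conjE)
  have ws\<A>: "\<And>A. A \<in> \<A> \<Longrightarrow> A \<inter> set ws = {}"
    "\<And>A W. A \<in> \<A> \<Longrightarrow> W \<subseteq> set ws \<Longrightarrow> card (A \<union> W) \<le> k \<Longrightarrow> \<chi> (A \<union> W) = \<chi> A"
    using gen by simp_all
  let ?B = "{B \<in> (\<lambda>(A, W). A \<union> W) ` (\<A> \<times> Pow (set ws)). card B < k}"
  have "finite ?B" using assms(1) by simp
  moreover have "finite (F \<union> set ws \<union> \<Union>\<A>)" using assms by auto
  moreover have "finite B \<and> card B < k" if "B \<in> ?B" for B
    using that assms(3) by (auto intro: finite_subset)
  ultimately obtain w where w: "w \<notin> F \<union> set ws \<union> \<Union>\<A>" "\<forall>B\<in>?B. \<chi> (insert w B) = \<chi> B"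
    using generic_vertex[of ?B "F \<union> set ws \<union> \<Union>\<A>"] by blast
  have "\<chi> (A \<union> W) = \<chi> A" if A: "A \<in> \<A>" and W: "W \<subseteq> set (w # ws)" "card (A \<union> W) \<le> k" for A W
  proof (cases "w \<in> W")
    case True
    define W0 where "W0 = W - {w}"
    have W0: "W0 \<subseteq> set ws" "A \<union> W = insert w (A \<union> W0)" using W True by (auto simp: W0_def)
    have "w \<notin> A \<union> W0" using w(1) A W0(1) by auto
    moreover have "finite (A \<union> W0)" using assms(3) A finite_subset[OF W0(1)] by simp
    ultimately have "card (A \<union> W0) < k" using W(2) W0(2) by simp
    moreover from this have "A \<union> W0 \<in> ?B" using A W0(1) by auto
    ultimately show ?thesis using w(2) ws\<A>(2)[OF A W0(1)] W0(2) by simp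
  next
    case False
    then have "W \<subseteq> set ws" using W(1) by auto
    then show ?thesis using ws\<A>(2)[OF A] W(2) by blast
  qed
  moreover have "A \<inter> set (w # ws) = {}" if "A \<in> \<A>" for A
    using ws\<A>(1)[OF that] w(1) that by auto
  moreover have "length (w # ws) = Suc n" "distinct (w # ws)" "set (w # ws) \<inter> F = {}"
    using ws w(1) by auto
  ultimately show ?case by (intro exI[of _ "w # ws"] conjI ballI allI impI)
qed

text \<open>\<open>A\<close> is padded with generic vertices. Keeping the padding away from
  \<open>F\<close> is what later distinguishes the edges.\<close>

lemma generic_edge:
  assumes A: "finite A" "card A \<le> k" and "finite F"
  shows "\<exists>e. A \<subseteq> e \<and> finite e \<and> card e = k \<and> e \<inter> F \<subseteq> A \<and> \<chi> e = \<chi> A"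
proof -
  obtain ws where "length ws = k - card A" "distinct ws" "set ws \<inter> F = {}" "A \<inter> set ws = {}"
      "\<forall>W\<subseteq>set ws. card (A \<union> W) \<le> k \<longrightarrow> \<chi> (A \<union> W) = \<chi> A"
    using generic_list[of "{A}" F "k - card A"] assms by auto
  moreover from this have "card (A \<union> set ws) = k"
    using A by (simp add: card_Un_disjoint distinct_card)
  ultimately show ?thesis
    using A by (intro exI[of _ "A \<union> set ws"]) auto
qed

text \<open>In contrast to \<open>finite_berge_path\<close>, a path without edges has \<open>t - 1\<close> vertices here.\<close>

definition list_path :: "'c \<Rightarrow> 'a list \<Rightarrow> 'a set list \<Rightarrow> bool" where
  "list_path c xs es \<longleftrightarrow> distinct xs \<and> distinct es \<and> Suc (length xs) = length es + t \<and>
    (\<forall>e\<in>set es. finite e \<and> card e = k \<and> \<chi> e = c) \<and>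
    (\<forall>i<length es. \<forall>j<t. xs ! (i + j) \<in> es ! i)"

lemma list_path_snoc:
  assumes p: "list_path c xs es" and x: "x \<notin> set xs"
    and e: "e \<notin> set es" "finite e" "card e = k" "\<chi> e = c"
    and sub: "insert x (end_segment t xs) \<subseteq> e"
  shows "list_path c (xs @ [x]) (es @ [e])"
proof -
  have len: "Suc (length xs) = length es + t" using p by (simp add: list_path_def)
  have "(xs @ [x]) ! (i + j) \<in> (es @ [e]) ! i" if "i < Suc (length es)" "j < t" for i j
  proof (cases "i < length es")
    case True
    then show ?thesis using p that len by (auto simp: list_path_def nth_append)
  next
    case False
    then have i: "i = length es" using that by simp
    show ?thesis
    proof (cases "i + j < length xs")
      case True
      \<comment> \<open>The window of the new edge starts exactly where the end segment
        does.\<close>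
      have "Suc (length xs) - t = i" using len i by simp
      then have "xs ! (i + j) = drop (Suc (length xs) - t) xs ! j"
          "j < length (drop (Suc (length xs) - t) xs)"
        using True by simp_all
      then have "xs ! (i + j) \<in> end_segment t xs"
        unfolding end_segment_def by (metis nth_mem)
      then show ?thesis using True i sub by (auto simp: nth_append)
    next
      case False
      then have "i + j = length xs" using that len i by simp
      then show ?thesis using i sub by (auto simp: nth_append)
    qed
  qed
  then show ?thesis
    using p x e by (auto simp: list_path_def)
qed

text \<open>As the last vertex is in \<open>Z\<close>, at most \<open>t - 2\<close> of the last \<open>t - 1\<close> vertices are outside \<open>Z\<close>, so
  that together with \<open>Z\<close> they leave room for one more vertex in an edge.\<close>

definition extendable :: "'c \<Rightarrow> 'a list \<Rightarrow> 'a set list \<Rightarrow> 'a set \<Rightarrow> bool" where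
  "extendable c xs es Z \<longleftrightarrow> list_path c xs es \<and> es \<noteq> [] \<and> last xs \<in> Z \<and>
    finite Z \<and> card Z = k - t + 1 \<and> (\<forall>W\<subseteq>end_segment t xs - Z. \<chi> (Z \<union> W) = c)"

lemma extendable_nonempty: "extendable c xs es Z \<Longrightarrow> xs \<noteq> []"
  using two_le_t by (auto simp: extendable_def list_path_def)

text \<open>The edge \<open>Z \<union> set ws\<close> has \<open>(k - t + 1) + (t - 1) = k\<close>
  vertices and contains the window \<open>ws @ [v]\<close>. As \<open>v\<close> is in
  \<open>Z\<close>, the new end segment lies in \<open>Z \<union> set ws\<close>, where all colours
  are known. This serves both to start a path and to close a step.\<close>

lemma extendable_snoc_generic:
  assumes p: "list_path c (xs @ ws) es" and ws: "length ws = t - 1" "set ws \<inter> Z = {}"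
    and v: "v \<in> Z" "v \<notin> set xs" and Z: "finite Z" "card Z = k - t + 1" "Z \<union> set ws \<notin> set es"
    and \<chi>: "\<And>W. W \<subseteq> set ws \<Longrightarrow> \<chi> (Z \<union> W) = c"
  shows "extendable c (xs @ ws @ [v]) (es @ [Z \<union> set ws]) Z"
proof -
  have v': "v \<notin> set (xs @ ws)" using v ws by auto
  have "distinct ws" using p by (simp add: list_path_def)
  then have "card (Z \<union> set ws) = k"
    using Z ws two_le_t t_le_k by (simp add: card_Un_disjoint Int_commute distinct_card)
  moreover have "end_segment t (xs @ ws) = set ws"
    using ws two_le_t by (intro end_segment_append_full) auto
  ultimately have "list_path c ((xs @ ws) @ [v]) (es @ [Z \<union> set ws])"
    using v Z \<chi>[of "set ws"] by (intro list_path_snoc[OF p v']) auto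
  moreover have "end_segment t ((xs @ ws) @ [v]) - Z \<subseteq> set ws"
    using end_segment_append[of t "xs @ ws" "[v]"] \<open>end_segment t (xs @ ws) = set ws\<close> v by auto
  ultimately show ?thesis
    using Z v \<chi> by (auto simp: extendable_def)
qed

text \<open>The path has the single edge \<open>Z \<union> set ws\<close>, and \<open>v\<close> is
  placed last so that the path ends in \<open>Z\<close>.\<close>

lemma extendable_start:
  assumes v: "v \<in> Z" and Z: "finite Z" "card Z = k - t + 1" "\<chi> Z = c" and "finite G"
  shows "\<exists>xs es. extendable c xs es Z \<and> v \<in> set xs \<and> set xs \<inter> G \<subseteq> {v}"
proof -
  obtain ws where ws: "length ws = t - 1" "distinct ws" "set ws \<inter> G = {}" "Z \<inter> set ws = {}"
      "\<forall>W\<subseteq>set ws. card (Z \<union> W) \<le> k \<longrightarrow> \<chi> (Z \<union> W) = \<chi> Z"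
    using generic_list[of "{Z}" G "t - 1"] assms by auto
  have "\<chi> (Z \<union> W) = c" if "W \<subseteq> set ws" for W
  proof -
    have "card W \<le> t - 1"
      using card_mono[OF _ that] ws by (simp add: distinct_card)
    then have "card (Z \<union> W) \<le> k"
      using card_Un_le[of Z W] Z two_le_t t_le_k by simp
    then show ?thesis using ws(5) that Z by simp
  qed
  moreover have "list_path c ([] @ ws) []"
    using ws two_le_t by (simp add: list_path_def)
  ultimately have "extendable c ([] @ ws @ [v]) ([] @ [Z \<union> set ws]) Z"
    using ws v Z by (intro extendable_snoc_generic) auto
  then show ?thesis using ws by (intro exI[of _ "ws @ [v]"] exI[of _ "[Z \<union> set ws]"]) auto
qed

text \<open>The path leaves \<open>Z\<close> through \<open>ws\<close>, using edges that contain
  \<open>Z\<close> and the current window. The claims on \<open>fs\<close> keep edges distinct: each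
  vertex of \<open>ws\<close> is in no edge before its turn, and a later edge through
  \<open>v\<close> is none of \<open>fs\<close>.\<close>

lemma list_path_append_generic:
  assumes ext: "extendable c xs es Z" and v: "v \<notin> Z" "v \<notin> set xs"
    and ws: "length ws = t - 1" "distinct ws" "set ws \<inter> (insert v (Z \<union> set xs \<union> \<Union>(set es))) = {}"
    and \<chi>: "\<And>W0 W. W0 \<subseteq> end_segment t xs - Z \<Longrightarrow> W \<subseteq> set ws \<Longrightarrow> card (Z \<union> W0 \<union> W) \<le> k \<Longrightarrow>
      \<chi> (Z \<union> W0 \<union> W) = c"
    and n: "n \<le> t - 1"
  shows "\<exists>fs. list_path c (xs @ take n ws) (es @ fs) \<and>
    (\<forall>f\<in>set fs. v \<notin> f \<and> f \<inter> set ws \<subseteq> set (take n ws))"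
  using n
proof (induction n)
  case 0
  then show ?case using ext by (intro exI[of _ "[]"]) (auto simp: extendable_def)
next
  case (Suc n)
  then obtain fs where p: "list_path c (xs @ take n ws) (es @ fs)"
    and fs: "\<forall>f\<in>set fs. v \<notin> f \<and> f \<inter> set ws \<subseteq> set (take n ws)" by auto
  define w where "w = ws ! n"
  have take: "take (Suc n) ws = take n ws @ [w]"
    using Suc.prems ws(1) by (simp add: w_def take_Suc_conv_app_nth)
  have "distinct (take (Suc n) ws)" using ws(2) by (rule distinct_take)
  then have w: "w \<notin> set (take n ws)" unfolding take by simp
  have w_ws: "w \<in> set ws" using Suc.prems ws(1) by (simp add: w_def)
  have Z: "finite Z" "card Z = k - t + 1" "last xs \<in> Z" using ext by (auto simp: extendable_def)
  define Y where "Y = end_segment t (xs @ take n ws)"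
  have Y: "Y \<subseteq> end_segment t xs \<union> set (take n ws)" "card Y \<le> t - 1" "finite Y"
    unfolding Y_def using end_segment_append[of t xs "take n ws"] card_end_segment_le by auto
  \<comment> \<open>As \<open>Suc n \<le> t - 1\<close>, the window still reaches back to
    \<open>last xs\<close>, which saves one place in the edge.\<close>
  have "last xs \<in> Y"
    unfolding Y_def using Suc.prems ws(1) extendable_nonempty[OF ext]
    by (intro last_in_end_segment_append) auto
  then have "Y - Z \<subset> Y" using Z by blast
  then have "card (Y - Z) < card Y" using Y(3) by (rule psubset_card_mono[rotated])
  then have "card (Y - Z) \<le> t - 2" using Y(2) by simp
  \<comment> \<open>At most \<open>(k - t + 1) + (t - 2) + 1 = k\<close> vertices. All of
    \<open>Z\<close> is included because the colours are known only for sets containing it.\<close>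
  define A where "A = Z \<union> (Y - Z) \<union> {w}"
  have "card A \<le> card Z + card (Y - Z) + card {w}"
    unfolding A_def by (intro order_trans[OF card_Un_le] add_right_mono card_Un_le)
  then have A: "card A \<le> k" "finite A"
    using Z \<open>card (Y - Z) \<le> t - 2\<close> two_le_t t_le_k Y(3) by (auto simp: A_def)
  have A_eq: "A = Z \<union> ((Y \<inter> end_segment t xs) - Z) \<union> ((Y \<inter> set (take n ws)) \<union> {w})"
    using Y(1) by (auto simp: A_def)
  have "\<chi> A = c"
    unfolding A_eq by (rule \<chi>) (use w_ws A A_eq in \<open>auto dest: in_set_takeD\<close>)
  obtain e where e: "A \<subseteq> e" "finite e" "card e = k" "e \<inter> insert v (set ws) \<subseteq> A" "\<chi> e = \<chi> A"
    using generic_edge[OF A(2,1), of "insert v (set ws)"] by auto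
  \<comment> \<open>The vertex \<open>w\<close> separates \<open>e\<close> from all earlier
    edges.\<close>
  have "w \<in> e" using e(1) by (auto simp: A_def)
  moreover have "w \<notin> f" if "f \<in> set (es @ fs)" for f
    using that fs w w_ws ws(3) by auto
  ultimately have "e \<notin> set (es @ fs)" by blast
  moreover have "w \<notin> set (xs @ take n ws)" using w w_ws ws(3) by auto
  ultimately have "list_path c ((xs @ take n ws) @ [w]) ((es @ fs) @ [e])"
    using e \<open>\<chi> A = c\<close> by (intro list_path_snoc[OF p]) (auto simp: A_def Y_def)
  moreover have "end_segment t xs \<subseteq> set xs" by (rule end_segment_subset)
  then have "v \<notin> A" "A \<inter> set ws \<subseteq> set (take (Suc n) ws)"
    using v ws(3) Y(1) w_ws by (auto simp: A_def take dest: in_set_takeD)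
  then have "v \<notin> e" "e \<inter> set ws \<subseteq> set (take (Suc n) ws)" using e(4) by auto
  ultimately show ?case
    using fs by (intro exI[of _ "fs @ [e]"]) (auto simp: take)
qed

text \<open>\<open>G\<close> stands for the vertices that are reserved or on other paths;
  \<open>v\<close> is the only one of them that may be used. The end set changes to
  \<open>Z'\<close> only if \<open>v\<close> is outside \<open>Z\<close>.\<close>

lemma extendable_step:
  assumes ext: "extendable c xs es Z" and v: "v \<notin> set xs" and "finite G"
    and Z': "v \<in> Z'" "finite Z'" "card Z' = k - t + 1" "\<chi> Z' = c"
  shows "\<exists>ys fs Z''. extendable c (xs @ ys) (es @ fs) Z'' \<and> v \<in> set ys \<and> set ys \<inter> G \<subseteq> {v}"
proof -
  have p: "list_path c xs es" and Z: "finite Z" "card Z = k - t + 1" "last xs \<in> Z"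
    and \<chi>Z: "\<And>W. W \<subseteq> end_segment t xs - Z \<Longrightarrow> \<chi> (Z \<union> W) = c"
    using ext by (auto simp: extendable_def)
  have fin_es: "finite (\<Union>(set es))" using p by (auto simp: list_path_def)
  show ?thesis
  proof (cases "v \<in> Z")
    case True
    \<comment> \<open>\<open>?A\<close> has at most \<open>(k - t + 1) + (t - 2) = k - 1\<close>
      vertices, so an edge containing it needs a padding vertex. This vertex is taken outside all
      earlier edges, so that the edge is new.\<close>
    let ?A = "Z \<union> (end_segment t xs - Z)"
    have "last xs \<in> end_segment t xs"
      using last_in_end_segment_append[of xs "[]" t] extendable_nonempty[OF ext] two_le_t by simp
    then have "end_segment t xs - Z \<subset> end_segment t xs" using Z by blast
    then have "card (end_segment t xs - Z) < card (end_segment t xs)"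
      by (rule psubset_card_mono[rotated]) simp
    then have A: "card ?A < k" "finite ?A"
      using card_Un_le[of Z "end_segment t xs - Z"] Z two_le_t t_le_k card_end_segment_le[of t xs]
      by auto
    obtain e where e: "?A \<subseteq> e" "finite e" "card e = k" "e \<inter> \<Union>(set es) \<subseteq> ?A" "\<chi> e = \<chi> ?A"
      using generic_edge[OF A(2) less_imp_le[OF A(1)] fin_es] by auto
    have "e \<notin> set es"
    proof
      assume "e \<in> set es"
      then have "e = ?A" using e by auto
      then show False using e A by simp
    qed
    then have "list_path c (xs @ [v]) (es @ [e])"
      using e True \<chi>Z[of "end_segment t xs - Z"] by (intro list_path_snoc[OF p v]) auto
    moreover have "end_segment t (xs @ [v]) - Z \<subseteq> end_segment t xs - Z"
      using end_segment_append[of t xs "[v]"] True by auto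
    ultimately have "extendable c (xs @ [v]) (es @ [e]) Z"
      using Z True \<chi>Z unfolding extendable_def by auto
    then show ?thesis by (intro exI[of _ "[v]"] exI[of _ "[e]"] exI[of _ Z]) auto
  next
    case False
    \<comment> \<open>The vertices \<open>ws\<close> must be generic over both end sets: over each
      \<open>Z \<union> W0\<close> for the edges that leave \<open>Z\<close>, over \<open>Z'\<close>
      for the closing edge.\<close>
    define \<A> where "\<A> = insert Z' ((\<lambda>W0. Z \<union> W0) ` Pow (end_segment t xs - Z))"
    define F where "F = insert v (Z \<union> set xs \<union> \<Union>(set es)) \<union> G"
    have fin: "finite \<A>" and finA: "\<forall>A\<in>\<A>. finite A"
      using Z(1) Z'(2) by (auto simp: \<A>_def dest: finite_subset[OF _ finite_Diff[OF finite_end_segment]])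
    have finF: "finite F" using Z(1) fin_es \<open>finite G\<close> by (simp add: F_def)
    obtain ws where ws: "length ws = t - 1" "distinct ws" "set ws \<inter> F = {}"
      and gen: "\<forall>A\<in>\<A>. A \<inter> set ws = {} \<and>
        (\<forall>W\<subseteq>set ws. card (A \<union> W) \<le> k \<longrightarrow> \<chi> (A \<union> W) = \<chi> A)"
      using generic_list[OF fin finF finA, of "t - 1"] by (elim exE conjE)
    have ws\<A>: "\<And>A. A \<in> \<A> \<Longrightarrow> A \<inter> set ws = {}"
      "\<And>A W. A \<in> \<A> \<Longrightarrow> W \<subseteq> set ws \<Longrightarrow> card (A \<union> W) \<le> k \<Longrightarrow> \<chi> (A \<union> W) = \<chi> A"
      using gen by simp_all
    have \<chi>1: "\<chi> (Z \<union> W0 \<union> W) = c"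
      if "W0 \<subseteq> end_segment t xs - Z" "W \<subseteq> set ws" "card (Z \<union> W0 \<union> W) \<le> k" for W0 W
      using ws\<A>(2)[of "Z \<union> W0" W] that \<chi>Z[of W0] by (auto simp: \<A>_def)
    have \<chi>2: "\<chi> (Z' \<union> W) = c" if "W \<subseteq> set ws" for W
    proof -
      have "card W \<le> t - 1"
        using card_mono[OF _ that] ws by (simp add: distinct_card)
      then have "card (Z' \<union> W) \<le> k"
        using card_Un_le[of Z' W] Z' two_le_t t_le_k by simp
      then show ?thesis using ws\<A>(2)[of Z' W] that Z' by (simp add: \<A>_def)
    qed
    have ws': "set ws \<inter> insert v (Z \<union> set xs \<union> \<Union>(set es)) = {}"
      using ws(3) by (auto simp: F_def)
    obtain fs where fs: "list_path c (xs @ take (t - 1) ws) (es @ fs)" "\<forall>f\<in>set fs. v \<notin> f"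
      using list_path_append_generic[OF ext False v ws(1,2) ws' \<chi>1 order_refl] by blast
    then have p': "list_path c (xs @ ws) (es @ fs)" using ws(1) by simp
    \<comment> \<open>This is where \<open>v \<notin> Z\<close> matters: for \<open>Z' = Z\<close> the edge
      \<open>Z' \<union> set ws\<close> would already be the last one of \<open>fs\<close>.\<close>
    have "Z' \<union> set ws \<notin> set fs" using fs(2) Z'(1) by blast
    moreover obtain w where "w \<in> set ws" using ws(1) two_le_t by (cases ws) auto
    then have "w \<notin> \<Union>(set es)" using ws' by auto
    then have "Z' \<union> set ws \<notin> set es" using \<open>w \<in> set ws\<close> by auto
    ultimately have "extendable c (xs @ ws @ [v]) ((es @ fs) @ [Z' \<union> set ws]) Z'"
      using ws(1) ws\<A>(1)[of Z'] v Z'(1-3) \<chi>2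
      by (intro extendable_snoc_generic[OF p']) (auto simp: \<A>_def)
    moreover have "set (ws @ [v]) \<inter> G \<subseteq> {v}" using ws(3) by (auto simp: F_def)
    ultimately show ?thesis
      by (intro exI[of _ "ws @ [v]"] exI[of _ "fs @ [Z' \<union> set ws]"] exI[of _ Z']) simp
  qed
qed

end

section \<open>Limits of growing paths\<close>

lemma prefix_chain_mono:
  assumes "\<And>n. prefix (L n) (L (Suc n))" "m \<le> n"
  shows "prefix (L m) (L n)"
  using assms(2)
proof (induction n rule: dec_induct)
  case (step n)
  then show ?case using assms(1) prefix_order.trans by blast
qed simp

text \<open>An entry never changes once it is present, so it can be read off from any list that is
  long enough.\<close>

lemma prefix_chain_limit:
  assumes chain: "\<And>n. prefix (L n) (L (Suc n))" and unbounded: "\<And>i. \<exists>n. i < length (L n)"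
    and dist: "\<And>n. distinct (L n)"
  shows "\<exists>f :: nat \<Rightarrow> 'a. (\<forall>n. \<forall>i<length (L n). L n ! i = f i) \<and> inj f \<and> range f = (\<Union>n. set (L n))"
proof -
  obtain N where N: "\<And>i. i < length (L (N i))" using unbounded by metis
  have agree: "L m ! i = L n ! i" if "m \<le> n" "i < length (L m)" for m n i
    using prefix_chain_mono[of L, OF chain that(1)] that(2) by (auto simp: prefix_def nth_append)
  define f where "f i = L (N i) ! i" for i
  have f: "L n ! i = f i" if "i < length (L n)" for n i
    unfolding f_def using agree[of n "N i" i] agree[of "N i" n i] that N[of i] by (metis nle_le)
  have "inj f"
  proof (rule injI)
    fix i j assume "f i = f j"
    define n where "n = N (max i j)"
    have "i < length (L n)" "j < length (L n)" using N[of "max i j"] by (auto simp: n_def)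
    then show "i = j" using f[of i n] f[of j n] \<open>f i = f j\<close> dist[of n]
      by (metis nth_eq_iff_index_eq)
  qed
  moreover have "range f = (\<Union>n. set (L n))"
  proof
    show "range f \<subseteq> (\<Union>n. set (L n))" 
      unfolding f_def using nth_mem[OF N] by blast
    show "(\<Union>n. set (L n)) \<subseteq> range f" using f by (auto simp: in_set_conv_nth)
  qed
  ultimately show ?thesis using f by blast
qed

lemma core_berge_path_nonempty:
  assumes "berge_path t H P" "2 \<le> t"
  shows "core P \<noteq> {}"
  using assms by (auto simp: berge_path_def finite_berge_path_def infinite_berge_path_def
      lessThan_empty_iff split: if_splits)

definition covering_colours :: "nat \<Rightarrow> ('a set \<Rightarrow> 'c) \<Rightarrow> 'c set \<Rightarrow> bool" where
  "covering_colours m \<chi> C \<longleftrightarrow> (\<forall>v. \<exists>Z. v \<in> Z \<and> finite Z \<and> card Z = m \<and> \<chi> Z \<in> C)"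

context generic_colouring
begin

lemma finite_berge_path_of_list_path:
  assumes p: "list_path c xs es" and "es \<noteq> []"
  shows "finite_berge_path t (complete_kgraph UNIV k) (length es) (set xs, set es)"
proof -
  have len: "length es + t - 1 = length xs" using p two_le_t by (auto simp: list_path_def)
  have "inj_on ((!) xs) {..<length xs}" "inj_on ((!) es) {..<length es}"
    using p by (auto simp: list_path_def intro!: inj_on_nth)
  moreover have "(!) xs ` {..<length xs} = set xs" "(!) es ` {..<length es} = set es"
    by (auto simp: set_conv_nth)
  moreover have "set es \<subseteq> nsets UNIV k" using p by (auto simp: list_path_def nsets_def)
  moreover have "(!) xs ` {i..<i + t} \<subseteq> es ! i" if "i < length es" for i
  proof clarify
    fix j assume j: "j \<in> {i..<i + t}"
    then have "j - i < t" by auto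
    then have "xs ! (i + (j - i)) \<in> es ! i" using p that unfolding list_path_def by blast
    then show "xs ! j \<in> es ! i" using j by simp
  qed
  ultimately show ?thesis
    using \<open>es \<noteq> []\<close> unfolding finite_berge_path_def len complete_kgraph_def
    by (simp, intro exI[of _ "(!) xs"] conjI exI[of _ "(!) es"]) simp_all
qed

text \<open>The vertex lists either stop growing, which gives a finite path, or grow to an infinite
  one; the edge lists grow along, being shorter by the constant \<open>t - 1\<close>. The condition
  on \<open>E 0\<close> excludes list paths without edges, whose \<open>t - 1\<close> vertices need
  not form a Berge-path of length 0.\<close>

lemma berge_path_limit:
  assumes p: "\<And>n. list_path c (L n) (E n)" and ne: "E 0 \<noteq> []"
    and chain: "\<And>n. prefix (L n) (L (Suc n))" "\<And>n. prefix (E n) (E (Suc n))"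
  shows "\<exists>P. berge_path t (complete_kgraph UNIV k) P \<and> monochromatic_in \<chi> c P \<and>
    core P = (\<Union>n. set (L n))"
proof (cases "\<exists>N. \<forall>n. length (L n) \<le> length (L N)")
  case True
  then obtain N where N: "\<And>n. length (L n) \<le> length (L N)" by blast
  have "set (L n) \<subseteq> set (L N)" for n
  proof (cases "n \<le> N")
    case True
    then show ?thesis using prefix_chain_mono[of L, OF chain(1)] set_mono_prefix by blast
  next
    case False
    then have "prefix (L N) (L n)" by (intro prefix_chain_mono[of L, OF chain(1)]) simp
    then have "L N = L n" using N[of n] by (auto simp: prefix_def)
    then show ?thesis by simp
  qed
  then have "(\<Union>n. set (L n)) = set (L N)" by blast
  moreover have "E N \<noteq> []"
    using prefix_chain_mono[of E, OF chain(2), of 0 N] ne by auto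
  then have "berge_path t (complete_kgraph UNIV k) (set (L N), set (E N))"
    unfolding berge_path_def using finite_berge_path_of_list_path[OF p] by blast
  moreover have "monochromatic_in \<chi> c (set (L N), set (E N))"
    using p[of N] by (auto simp: monochromatic_in_def list_path_def)
  ultimately show ?thesis by (intro exI[of _ "(set (L N), set (E N))"]) simp
next
  case False
  have L_unbounded: "\<exists>n. i < length (L n)" for i
  proof (induction i)
    case 0
    from False show ?case by (metis le0 not_gr_zero order_refl linorder_not_le)
  next
    case (Suc i)
    then show ?case using False by (metis Suc_lessI linorder_not_le less_trans)
  qed
  have len: "Suc (length (L n)) = length (E n) + t" for n using p[of n] by (simp add: list_path_def)
  have E_unbounded: "\<exists>n. i < length (E n)" for i
    using L_unbounded[of "i + t"] len by (metis Suc_lessD add_less_cancel_right Suc_mono)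
  obtain v where v: "\<forall>n. \<forall>i<length (L n). L n ! i = v i" "inj v" "range v = (\<Union>n. set (L n))"
    using prefix_chain_limit[of L, OF chain(1) L_unbounded] p by (auto simp: list_path_def)
  obtain e where e: "\<forall>n. \<forall>i<length (E n). E n ! i = e i" "inj e" "range e = (\<Union>n. set (E n))"
    using prefix_chain_limit[of E, OF chain(2) E_unbounded] p by (auto simp: list_path_def)
  have "v ` {i..<i + t} \<subseteq> e i" for i
  proof clarify
    fix j assume j: "j \<in> {i..<i + t}"
    obtain n where n: "i < length (E n)" using E_unbounded by blast
    moreover have "j - i < t" using j by auto
    ultimately have "L n ! (i + (j - i)) \<in> E n ! i" using p[of n] unfolding list_path_def by blast
    moreover have "j < length (L n)" using j n len[of n] by auto
    ultimately show "v j \<in> e i" using v(1) e(1) n j by auto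
  qed
  moreover have "range e \<subseteq> nsets UNIV k"
    unfolding e(3) using p by (auto simp: list_path_def nsets_def)
  ultimately have "infinite_berge_path t (complete_kgraph UNIV k) (range v, range e)"
    unfolding infinite_berge_path_def complete_kgraph_def using v(2) e(2)
    by (intro exI[of _ v] exI[of _ e]) auto
  moreover have "monochromatic_in \<chi> c (range v, range e)"
    unfolding e(3) monochromatic_in_def using p by (auto simp: list_path_def)
  ultimately show ?thesis
    using v(3) by (intro exI[of _ "(range v, range e)"]) (simp add: berge_path_def)
qed

section \<open>Simultaneous construction of disjoint paths\<close>

text \<open>\<open>st\<close> is the state of the greedy construction. It does not record the end
  sets, since a step may replace them.\<close>

definition disjoint_paths :: "'c set \<Rightarrow> ('c \<Rightarrow> 'a list \<times> 'a set list) \<Rightarrow> bool" where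
  "disjoint_paths C st \<longleftrightarrow> (\<forall>c\<in>C. \<exists>Z. extendable c (fst (st c)) (snd (st c)) Z) \<and>
    disjoint_family_on (\<lambda>c. set (fst (st c))) C"

lemma disjoint_paths_start:
  assumes "finite S" "finite C" "inj_on p C"
    and p: "\<forall>c\<in>C. \<exists>Z. p c \<in> Z \<and> finite Z \<and> card Z = k - t + 1 \<and> \<chi> Z = c"
  shows "\<exists>st. disjoint_paths C st \<and> (\<forall>c\<in>C. set (fst (st c)) \<inter> S \<subseteq> {p c})"
proof -
  \<comment> \<open>The induction also keeps each path away from the starting vertices of all other
    colours, including those whose paths are not yet built.\<close>
  have "\<exists>st. disjoint_paths D st \<and> (\<forall>c\<in>D. set (fst (st c)) \<inter> (S \<union> p ` C) \<subseteq> {p c})"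
    if "finite D" "D \<subseteq> C" for D
    using that
  proof (induction D)
    case empty
    then show ?case by (auto simp: disjoint_paths_def disjoint_family_on_def)
  next
    case (insert d D)
    then obtain st where st: "disjoint_paths D st"
      "\<And>c. c \<in> D \<Longrightarrow> set (fst (st c)) \<inter> (S \<union> p ` C) \<subseteq> {p c}" by auto
    let ?G = "S \<union> p ` C \<union> (\<Union>c\<in>D. set (fst (st c)))"
    have "finite ?G" using insert assms by auto
    moreover obtain Z where "p d \<in> Z" "finite Z" "card Z = k - t + 1" "\<chi> Z = d"
      using p insert.prems by auto
    ultimately obtain xs es where xs: "extendable d xs es Z" "set xs \<inter> ?G \<subseteq> {p d}"
      using extendable_start by metis
    have "set xs \<inter> set (fst (st c)) = {}" if "c \<in> D" for c
    proof -
      have "p d \<notin> set (fst (st c))"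
      proof
        assume "p d \<in> set (fst (st c))"
        then have "p d = p c" using st(2)[OF that] insert.prems by auto
        then show False using insert that assms(3) by (auto dest!: inj_onD)
      qed
      then show ?thesis using xs(2) that by auto
    qed
    then have "disjoint_paths (insert d D) (st(d := (xs, es)))"
      using st(1) xs(1) insert.hyps(2)
      by (auto simp: disjoint_paths_def disjoint_family_on_def)
    moreover have "set (fst ((st(d := (xs, es))) c)) \<inter> (S \<union> p ` C) \<subseteq> {p c}"
      if "c \<in> insert d D" for c
      using that st(2)[of c] xs(2) by auto
    ultimately show ?case by blast
  qed
  from this[OF assms(2) order_refl] show ?thesis by blast
qed

text \<open>Unless \<open>v\<close> is in \<open>S\<close> or already covered, the path of colour
  \<open>\<chi> Z\<close> grows and the others stay. The added vertices avoid \<open>S\<close> and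
  all current cores, so disjointness survives.\<close>

lemma disjoint_paths_step:
  assumes "finite S" "finite C" and st: "disjoint_paths C st"
    and S: "\<And>c. c \<in> C \<Longrightarrow> set (fst (st c)) \<inter> S = {}"
    and v: "v \<in> Z" "finite Z" "card Z = k - t + 1" "\<chi> Z \<in> C"
  shows "\<exists>st'. (disjoint_paths C st' \<and> (\<forall>c\<in>C. set (fst (st' c)) \<inter> S = {})) \<and>
    (\<forall>c\<in>C. prefix (fst (st c)) (fst (st' c)) \<and> prefix (snd (st c)) (snd (st' c))) \<and>
    (v \<in> S \<or> (\<exists>c\<in>C. v \<in> set (fst (st' c))))"
proof (cases "v \<in> S \<or> (\<exists>c\<in>C. v \<in> set (fst (st c)))")
  case True
  then show ?thesis using st S by (intro exI[of _ st]) auto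
next
  case False
  define d where "d = \<chi> Z"
  obtain xs es where d: "st d = (xs, es)" by fastforce
  obtain Z0 where Z0: "extendable d xs es Z0"
    using st v(4) d unfolding disjoint_paths_def d_def by fastforce
  let ?G = "S \<union> (\<Union>c\<in>C. set (fst (st c)))"
  have "finite ?G" using assms by auto
  moreover have "v \<notin> set xs" using False v(4) d by (auto simp: d_def)
  ultimately obtain ys fs Z1
    where ys: "extendable d (xs @ ys) (es @ fs) Z1" "v \<in> set ys" "set ys \<inter> ?G \<subseteq> {v}"
    using extendable_step[OF Z0 _ _ v(1-3)] d_def by metis
  define st' where "st' = st(d := (xs @ ys, es @ fs))"
  have G: "set ys \<inter> ?G = {}" using ys(3) False by auto
  have "set (xs @ ys) \<inter> set (fst (st c)) = {}" if "c \<in> C" "c \<noteq> d" for c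
    using G st that v(4) d unfolding disjoint_paths_def disjoint_family_on_def d_def by fastforce
  then have "disjoint_paths C st'"
    using st ys(1) by (auto simp: disjoint_paths_def disjoint_family_on_def st'_def)
  moreover have "set (fst (st' c)) \<inter> S = {}" if "c \<in> C" for c
    using S[OF that] G d by (auto simp: st'_def)
  moreover have "prefix (fst (st c)) (fst (st' c)) \<and> prefix (snd (st c)) (snd (st' c))" for c
    using d by (auto simp: st'_def)
  moreover have "v \<in> set (fst (st' d))" "d \<in> C" using ys(2) v(4) by (auto simp: st'_def d_def)
  ultimately show ?thesis by blast
qed

text \<open>Stage \<open>n\<close> of a dependent choice deals with the vertex \<open>u n\<close>,
  so every vertex outside \<open>S\<close> is covered eventually. The vertices of \<open>S\<close>
  are left for paths of length 0.\<close>

lemma berge_paths_covering: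
  fixes u :: "nat \<Rightarrow> 'a"
  assumes "surj u" "finite S" "finite C" "inj_on p C" "p ` C \<inter> S = {}"
    and p: "\<forall>c\<in>C. \<exists>Z. p c \<in> Z \<and> finite Z \<and> card Z = k - t + 1 \<and> \<chi> Z = c"
    and cover: "covering_colours (k - t + 1) \<chi> C"
  shows "\<exists>P. (\<forall>c\<in>C. berge_path t (complete_kgraph UNIV k) (P c) \<and> monochromatic_in \<chi> c (P c)) \<and>
    disjoint_family_on (\<lambda>c. core (P c)) C \<and> (\<Union>c\<in>C. core (P c)) = - S"
proof -
  let ?I = "\<lambda>st. disjoint_paths C st \<and> (\<forall>c\<in>C. set (fst (st c)) \<inter> S = {})"
  let ?Q = "\<lambda>n st st'. (\<forall>c\<in>C. prefix (fst (st c)) (fst (st' c)) \<and> prefix (snd (st c)) (snd (st' c))) \<and>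
    (u n \<in> S \<or> (\<exists>c\<in>C. u n \<in> set (fst (st' c))))"
  have "\<exists>f. \<forall>n. ?I (f n) \<and> ?Q n (f n) (f (Suc n))"
  proof (rule dependent_nat_choice)
    obtain st where "disjoint_paths C st" "\<forall>c\<in>C. set (fst (st c)) \<inter> S \<subseteq> {p c}"
      using disjoint_paths_start[OF assms(2-4) p] by blast
    then show "\<exists>st. ?I st" using assms(5) by (intro exI[of _ st]) auto
  next
    fix st n assume "?I st"
    then show "\<exists>st'. ?I st' \<and> ?Q n st st'"
      using cover disjoint_paths_step[OF assms(2,3), of st "u n"]
      unfolding covering_colours_def by metis
  qed
  then obtain f where f: "\<And>n. disjoint_paths C (f n)" "\<And>n c. c \<in> C \<Longrightarrow> set (fst (f n c)) \<inter> S = {}"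
    and pre: "\<And>n c. c \<in> C \<Longrightarrow> prefix (fst (f n c)) (fst (f (Suc n) c))"
      "\<And>n c. c \<in> C \<Longrightarrow> prefix (snd (f n c)) (snd (f (Suc n) c))"
    and cov: "\<And>n. u n \<in> S \<or> (\<exists>c\<in>C. u n \<in> set (fst (f (Suc n) c)))"
    by blast
  have "\<exists>P. berge_path t (complete_kgraph UNIV k) P \<and> monochromatic_in \<chi> c P \<and>
      core P = (\<Union>n. set (fst (f n c)))" if "c \<in> C" for c
  proof (rule berge_path_limit)
    have "\<exists>Z. extendable c (fst (f n c)) (snd (f n c)) Z" for n
      using f(1)[of n] that by (auto simp: disjoint_paths_def)
    then show "list_path c (fst (f n c)) (snd (f n c))" "snd (f 0 c) \<noteq> []" for n
      by (auto simp: extendable_def)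
  qed (use pre that in auto)
  then obtain P where P: "\<And>c. c \<in> C \<Longrightarrow> berge_path t (complete_kgraph UNIV k) (P c)"
    "\<And>c. c \<in> C \<Longrightarrow> monochromatic_in \<chi> c (P c)"
    "\<And>c. c \<in> C \<Longrightarrow> core (P c) = (\<Union>n. set (fst (f n c)))" by metis
  have "core (P c) \<inter> core (P d) = {}" if "c \<in> C" "d \<in> C" "c \<noteq> d" for c d
  proof -
    \<comment> \<open>The lists of different stages are compared at the common later stage
      \<open>max m n\<close>.\<close>
    have "set (fst (f m c)) \<inter> set (fst (f n d)) = {}" for m n
    proof -
      have "prefix (fst (f m c)) (fst (f (max m n) c))" "prefix (fst (f n d)) (fst (f (max m n) d))"
        using prefix_chain_mono[of "\<lambda>n. fst (f n c)"] prefix_chain_mono[of "\<lambda>n. fst (f n d)"]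
          pre(1) that by simp_all
      then have "set (fst (f m c)) \<subseteq> set (fst (f (max m n) c))"
        "set (fst (f n d)) \<subseteq> set (fst (f (max m n) d))"
        by (auto dest: set_mono_prefix)
      moreover have "set (fst (f (max m n) c)) \<inter> set (fst (f (max m n) d)) = {}"
        using f(1)[of "max m n"] that by (auto simp: disjoint_paths_def disjoint_family_on_def)
      ultimately show ?thesis by blast
    qed
    then show ?thesis using P(3) that by auto
  qed
  then have "disjoint_family_on (\<lambda>c. core (P c)) C" by (auto simp: disjoint_family_on_def)
  moreover have "(\<Union>c\<in>C. core (P c)) = - S"
  proof
    show "(\<Union>c\<in>C. core (P c)) \<subseteq> - S" using P(3) f(2) by fastforce
    show "- S \<subseteq> (\<Union>c\<in>C. core (P c))"
    proof
      fix x assume "x \<in> - S"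
      moreover obtain n where "x = u n" using \<open>surj u\<close> by auto
      ultimately obtain c where "c \<in> C" "x \<in> set (fst (f (Suc n) c))" using cov[of n] by auto
      then show "x \<in> (\<Union>c\<in>C. core (P c))" using P(3) by auto
    qed
  qed
  ultimately show ?thesis using P by blast
qed

end

section \<open>Small sets of covering colours\<close>

lemma ex_covering_colours:
  fixes \<chi> :: "'a set \<Rightarrow> nat"
  assumes inf: "infinite (UNIV :: 'a set)" and "m \<ge> 1" "s \<ge> 1"
    and \<chi>: "\<forall>Z. finite Z \<longrightarrow> card Z = m \<longrightarrow> \<chi> Z \<in> {1..s * m}"
  shows "\<exists>C\<subseteq>{1..s * m}. card C \<le> s \<and> covering_colours m \<chi> C"
proof (rule ccontr)
  assume contr: "\<not> ?thesis"
  \<comment> \<open>The blocks are \<open>m\<close> consecutive intervals of \<open>s\<close>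
    colours; by \<open>contr\<close> none of them is covering.\<close>
  define B where "B i = {Suc (i * s)..i * s + s}" for i
  have "\<exists>v. \<forall>Z. v \<in> Z \<longrightarrow> finite Z \<longrightarrow> card Z = m \<longrightarrow> \<chi> Z \<notin> B i" if "i < m" for i
  proof -
    have "Suc i * s \<le> m * s" using that by (intro mult_le_mono1) simp
    then have "B i \<subseteq> {1..s * m}" by (auto simp: B_def mult.commute)
    moreover have "card (B i) \<le> s" by (simp add: B_def)
    ultimately have "\<not> covering_colours m \<chi> (B i)" using contr by blast
    then show ?thesis unfolding covering_colours_def by meson
  qed
  then obtain v where v: "\<And>i Z. i < m \<Longrightarrow> v i \<in> Z \<Longrightarrow> finite Z \<Longrightarrow> card Z = m \<Longrightarrow> \<chi> Z \<notin> B i"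
    by metis
  have card: "card (v ` {..<m}) \<le> m" using card_image_le[of "{..<m}" v] by simp
  have "infinite (- v ` {..<m})" using inf by (simp add: Compl_eq_Diff_UNIV)
  then obtain Y where Y: "finite Y" "card Y = m - card (v ` {..<m})" "Y \<subseteq> - v ` {..<m}"
    using infinite_arbitrarily_large by blast
  \<comment> \<open>The vertices \<open>v i\<close> may coincide, so \<open>Y\<close> pads them to
    exactly \<open>m\<close> elements.\<close>
  define Z where "Z = v ` {..<m} \<union> Y"
  have Z: "finite Z" "card Z = m"
    using Y card by (auto simp: Z_def card_Un_disjoint disjoint_eq_subset_Compl Int_commute)
  \<comment> \<open>The block of the colour of \<open>Z\<close>; colours start at 1, hence the
    subtraction.\<close>
  define i where "i = (\<chi> Z - 1) div s"
  have c: "1 \<le> \<chi> Z" "\<chi> Z \<le> s * m" using \<chi> Z by auto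
  then have "\<chi> Z - 1 < m * s" by (simp add: mult.commute)
  then have "i < m" unfolding i_def by (rule less_mult_imp_div_less)
  moreover have "i * s \<le> \<chi> Z - 1" "\<chi> Z - 1 < i * s + s"
    unfolding i_def using \<open>s \<ge> 1\<close> div_mult_mod_eq[of "\<chi> Z - 1" s] mod_less_divisor[of s "\<chi> Z - 1"]
    by linarith+
  then have "\<chi> Z \<in> B i" using c(1) unfolding B_def atLeastAtMost_iff by linarith
  ultimately show False using v[of i Z] Z by (auto simp: Z_def)
qed

text \<open>With \<open>card C\<close> minimal, \<open>C - {c}\<close> is not covering; a vertex
  that witnesses this lies only in \<open>m\<close>-sets whose colour is \<open>c\<close> or outside
  \<open>C\<close>.\<close>

lemma ex_minimal_covering_colours:
  fixes \<chi> :: "'a set \<Rightarrow> nat"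
  assumes inf: "infinite (UNIV :: 'a set)" and "m \<ge> 1" "s \<ge> 1"
    and \<chi>: "\<forall>Z. finite Z \<longrightarrow> card Z = m \<longrightarrow> \<chi> Z \<in> {1..s * m}"
  shows "\<exists>C\<subseteq>{1..s * m}. card C \<le> s \<and> covering_colours m \<chi> C \<and>
    (\<forall>c\<in>C. \<exists>v. \<forall>Z. v \<in> Z \<longrightarrow> finite Z \<longrightarrow> card Z = m \<longrightarrow> \<chi> Z \<in> C \<longrightarrow> \<chi> Z = c)"
proof -
  let ?P = "\<lambda>C. C \<subseteq> {1..s * m} \<and> card C \<le> s \<and> covering_colours m \<chi> C"
  obtain C0 where "?P C0" using ex_covering_colours[OF assms] by blast
  then obtain C where C: "?P C" and min: "\<And>D. ?P D \<Longrightarrow> card C \<le> card D"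
    using ex_has_least_nat[of ?P C0 card] by blast
  have "\<exists>v. \<forall>Z. v \<in> Z \<longrightarrow> finite Z \<longrightarrow> card Z = m \<longrightarrow> \<chi> Z \<in> C \<longrightarrow> \<chi> Z = c" if "c \<in> C" for c
  proof -
    have "finite C" using C finite_subset by blast
    then have less: "card (C - {c}) < card C" using that by (rule card_Diff1_less)
    have "\<not> covering_colours m \<chi> (C - {c})"
    proof
      assume "covering_colours m \<chi> (C - {c})"
      moreover have "C - {c} \<subseteq> {1..s * m}" "card (C - {c}) \<le> s" using C less by auto
      ultimately have "card C \<le> card (C - {c})" by (intro min conjI)
      with less show False by simp
    qed
    then obtain v where "\<not> (\<exists>Z. v \<in> Z \<and> finite Z \<and> card Z = m \<and> \<chi> Z \<in> C - {c})"
      unfolding covering_colours_def by blast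
    then show ?thesis by blast
  qed
  with C show ?thesis by blast
qed

section \<open>Assembly of the core-partition\<close>

theorem theorem1p5:
  fixes s k t r :: nat and \<phi> :: "nat set \<Rightarrow> nat"
  assumes "s \<ge> 1" and "t \<ge> 2" and "k \<ge> t"
    and "r = s * (k - t + 1)"
    and "edge_colouring r (complete_kgraph (UNIV :: nat set) k) \<phi>"
  shows "\<exists>(P :: nat \<Rightarrow> nat set \<times> nat set set) (c :: nat \<Rightarrow> nat).
           (\<forall>i \<in> {1..s}. berge_path t (complete_kgraph (UNIV :: nat set) k) (P i) \<and>
                          c i \<in> {1..r} \<and> monochromatic_in \<phi> (c i) (P i)) \<and>
           inj_on c {1..s} \<and>
           core_partition (UNIV :: nat set) s P"
proof -
  let ?H = "complete_kgraph (UNIV :: nat set) k"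
  have "\<phi> \<in> nsets UNIV k \<rightarrow> {1..r}"
    using assms(5) by (simp add: edge_colouring_def complete_kgraph_def)
  from generic_extension_of_colouring[OF infinite_UNIV_nat finite_atLeastAtMost this]
  obtain \<chi> where \<chi>\<phi>: "\<forall>A. finite A \<longrightarrow> card A = k \<longrightarrow> \<chi> A = \<phi> A"
    and \<chi>r: "\<forall>A. finite A \<longrightarrow> card A \<le> k \<longrightarrow> \<chi> A \<in> {1..r}"
    and gen: "\<forall>\<A> F. finite \<A> \<longrightarrow> finite F \<longrightarrow> (\<forall>A\<in>\<A>. finite A \<and> card A < k) \<longrightarrow>
      (\<exists>w. w \<notin> F \<and> (\<forall>A\<in>\<A>. \<chi> (insert w A) = \<chi> A))"
    by (elim exE conjE)
  interpret generic_colouring k t \<chi>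
    by unfold_locales (use assms gen in simp_all)
  define m where "m = k - t + 1"
  have m: "m \<ge> 1" "m \<le> k" "r = s * m" using assms by (auto simp: m_def)
  have "\<forall>Z. finite Z \<longrightarrow> card Z = m \<longrightarrow> \<chi> Z \<in> {1..s * m}"
    using \<chi>r m by auto
  from ex_minimal_covering_colours[OF infinite_UNIV_nat m(1) assms(1) this]
  obtain C where C: "C \<subseteq> {1..r}" "card C \<le> s"
    and cover: "covering_colours m \<chi> C"
    and priv: "\<forall>c\<in>C. \<exists>v. \<forall>Z. v \<in> Z \<longrightarrow> finite Z \<longrightarrow> card Z = m \<longrightarrow> \<chi> Z \<in> C \<longrightarrow> \<chi> Z = c"
    unfolding m(3) by blast
  obtain p where p: "\<And>c Z. c \<in> C \<Longrightarrow> p c \<in> Z \<Longrightarrow> finite Z \<Longrightarrow> card Z = m \<Longrightarrow> \<chi> Z \<in> C \<Longrightarrow> \<chi> Z = c"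
    using priv by metis
  have finC: "finite C" using C(1) finite_subset by blast
  \<comment> \<open>Some \<open>m\<close>-set through \<open>p c\<close> has its colour in
    \<open>C\<close>, and this colour can only be \<open>c\<close>.\<close>
  have pZ: "\<forall>c\<in>C. \<exists>Z. p c \<in> Z \<and> finite Z \<and> card Z = m \<and> \<chi> Z = c"
    using cover p unfolding covering_colours_def by metis
  \<comment> \<open>If \<open>p c = p d\<close>, then an \<open>m\<close>-set of colour
    \<open>c\<close> through this vertex must also have colour \<open>d\<close>.\<close>
  have inj: "inj_on p C"
    by (rule inj_onI) (metis pZ p)
  \<comment> \<open>As \<open>m \<ge> 1\<close>, there are at least \<open>s\<close> colours in all,
    enough to choose the remaining ones in \<open>D\<close>.\<close>
  have "s \<le> r" using m by simp
  have "card ({1..r} - C) = r - card C" using C(1) finC by (simp add: card_Diff_subset)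
  then obtain D where D: "D \<subseteq> {1..r} - C" "card D = s - card C" "finite D"
    using obtain_subset_with_card_n[of "s - card C" "{1..r} - C"] \<open>s \<le> r\<close> by (metis diff_le_mono)
  \<comment> \<open>\<open>S\<close> provides one vertex for each colour of \<open>D\<close> and
    avoids the starting vertices.\<close>
  have "infinite (- p ` C)" using finC by (simp add: Compl_eq_Diff_UNIV)
  then obtain S where S: "finite S" "card S = s - card C" "S \<subseteq> - p ` C"
    using infinite_arbitrarily_large[of "- p ` C" "s - card C"] by (elim meta_impE exE conjE)
  obtain h where h: "bij_betw h D S"
    using finite_same_card_bij[OF D(3) S(1)] D(2) S(2) by auto
  have pS: "p ` C \<inter> S = {}" using S(3) by blast
  obtain P where P: "\<And>c. c \<in> C \<Longrightarrow> berge_path t ?H (P c)" "\<And>c. c \<in> C \<Longrightarrow> monochromatic_in \<chi> c (P c)"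
    and disj: "disjoint_family_on (\<lambda>c. core (P c)) C" and un: "(\<Union>c\<in>C. core (P c)) = - S"
    using berge_paths_covering[OF surj_id S(1) finC inj pS, folded m_def, OF pZ cover]
    by (elim exE conjE) (rule that, simp_all)
  have "C \<inter> D = {}" using D(1) by blast
  then have CD: "C \<inter> D = {}" "finite (C \<union> D)" "card (C \<union> D) = s"
    using D C(2) finC by (simp_all add: card_Un_disjoint)
  then obtain c where c: "bij_betw c {1..s} (C \<union> D)"
    using finite_same_card_bij[of "{1..s}" "C \<union> D"] by auto
  \<comment> \<open>A path of length 0 has no edges and is thus monochromatic in any colour
    \<open>d\<close>.\<close>
  define Q where "Q d = (if d \<in> C then P d else ({h d}, {}))" for d
  have h_S: "h d \<in> S" if "d \<in> D" for d using h that by (auto simp: bij_betw_def)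
  have Q_path: "berge_path t ?H (Q d)" if "d \<in> C \<union> D" for d
    using that P(1) by (auto simp: Q_def berge_path_def finite_berge_path_def complete_kgraph_def
        intro!: exI[of _ 0])
  have Q_mono: "monochromatic_in \<phi> d (Q d)" if "d \<in> C \<union> D" for d
  proof (cases "d \<in> C")
    case True
    \<comment> \<open>\<open>\<chi>\<close> is known to agree with \<open>\<phi>\<close> only on
      sets of size \<open>k\<close>.\<close>
    have "snd (P d) \<subseteq> nsets UNIV k"
      using P(1)[OF True] by (auto simp: berge_path_def finite_berge_path_def
          infinite_berge_path_def complete_kgraph_def split: if_splits)
    then show ?thesis
      using P(2)[OF True] True \<chi>\<phi> by (auto simp: Q_def monochromatic_in_def nsets_def)
  qed (simp add: Q_def monochromatic_in_def)
  have Q_disj: "core (Q d) \<inter> core (Q d') = {}" if "d \<in> C \<union> D" "d' \<in> C \<union> D" "d \<noteq> d'" for d d'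
  proof -
    have "h d \<noteq> h d'" if "d \<in> D" "d' \<in> D"
      using h that \<open>d \<noteq> d'\<close> by (auto simp: bij_betw_def inj_on_def)
    moreover have "core (P d) \<inter> S = {}" if "d \<in> C" for d using un that by auto
    moreover have "core (P d) \<inter> core (P d') = {}" if "d \<in> C" "d' \<in> C"
      using disj that \<open>d \<noteq> d'\<close> unfolding disjoint_family_on_def by blast
    ultimately show ?thesis
      using that(1,2) h_S[of d] h_S[of d'] by (auto simp: Q_def)
  qed
  have "core (Q d) = {h d}" if "d \<in> D" for d using that CD(1) by (auto simp: Q_def)
  then have "(\<Union>d\<in>D. core (Q d)) = S" using h by (auto simp: bij_betw_def)
  moreover have "(\<Union>d\<in>C. core (Q d)) = - S" using un by (simp add: Q_def)
  ultimately have Q_un: "(\<Union>d\<in>C \<union> D. core (Q d)) = UNIV" unfolding UN_Un by simp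
  have c_in: "c i \<in> C \<union> D" if "i \<in> {1..s}" for i using c that by (auto simp: bij_betw_def)
  have c_inj: "inj_on c {1..s}" and c_im: "c ` {1..s} = C \<union> D" using c by (auto simp: bij_betw_def)
  have dis: "disjoint_family_on (\<lambda>i. core (Q (c i))) {1..s}"
    unfolding disjoint_family_on_def
  proof (intro ballI impI)
    fix i j assume "i \<in> {1..s}" "j \<in> {1..s}" "i \<noteq> j"
    then show "core (Q (c i)) \<inter> core (Q (c j)) = {}"
      by (intro Q_disj c_in) (use c_inj in \<open>simp_all add: inj_on_eq_iff\<close>)
  qed
  moreover have "partition_on UNIV ((\<lambda>i. core (Q (c i))) ` {1..s})"
  proof (rule partition_onI)
    show "\<Union>((\<lambda>i. core (Q (c i))) ` {1..s}) = UNIV"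
      using Q_un unfolding c_im[symmetric] by simp
    show "{} \<notin> (\<lambda>i. core (Q (c i))) ` {1..s}"
      using core_berge_path_nonempty[OF Q_path[OF c_in] assms(2)] by force
    show "disjnt X Y" if XY: "X \<in> (\<lambda>i. core (Q (c i))) ` {1..s}" "Y \<in> (\<lambda>i. core (Q (c i))) ` {1..s}"
      "X \<noteq> Y" for X Y
    proof -
      obtain i j where ij: "i \<in> {1..s}" "j \<in> {1..s}" "X = core (Q (c i))" "Y = core (Q (c j))"
        using XY by blast
      with XY(3) have "i \<noteq> j" by blast
      then show ?thesis
        using disjoint_family_onD[OF dis ij(1,2)] ij(3,4) by (simp add: disjnt_def)
    qed
  qed
  ultimately have "core_partition UNIV s (\<lambda>i. Q (c i))" by (simp add: core_partition_def)
  moreover have "c i \<in> {1..r}" if "i \<in> {1..s}" for i using c_in[OF that] C(1) D(1) by auto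
  ultimately show ?thesis
    using Q_path Q_mono c_in c_inj by (intro exI[of _ "\<lambda>i. Q (c i)"] exI[of _ c]) auto
qed

end
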